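(* Let $n\in\mathbb{N}$ and let $(\mathbf{c},\mathbf{X},\mathbf{B},\tilde f)$ be the parameters of an instance of CLEANING-2 of size $n$, where $\mathbf{c}=(c_1,\dots,c_n)\in\mathbb{R}^n$, $\mathbf{X}=(\mathbf{X}_1,\dots,\mathbf{X}_n)\in\mathbb{X}^n$, $\mathbf{B}=(B_0,B_1,\dots,B_n)\in\mathbb{R}^{n+1}$ and $\tilde f:\mathbb{X}\times\mathbb{R}\to\mathbb{R}$. For $0\le j<i\le n$, let $\Phi[i,j]$ denote the optimal objective value of SUB-PROBLEM$[i,j]$. Then CLEANING-2 satisfies the optimal substructure property; that is, the objective value of SUB-PROBLEM$[i,j]$ can be written in terms of the objective values of SUB-PROBLEM$[i+1,i]$ and SUB-PROBLEM$[i+1,j]$: for each pair of voyage indices $0\le j<i<n$, $$\Phi[i,j]=\min\Bigl\{\tilde f(\mathbf{X}_i,0)+c_i+\Phi[i+1,i],\ \ \tilde f\Bigl(\mathbf{X}_i,\sum_{k=j}^{i-1}B_k\Bigr)+\Phi[i+1,j]\Bigr\}.$$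
   Context: Let $\mathbb{X}$ be the set of voyage profiles (the disjoint union of the matrix spaces $\mathbb{R}^{m_j\times q}$, where $q$ is a fixed number of features and $m_j\in\mathbb{N}$ is the number of observations of voyage $j$). Problem CLEANING-2. Given $n\in\mathbb{N}$ and parameters $(\mathbf{c},\mathbf{X},\mathbf{B},\tilde f)$ with $\mathbf{c}=(c_1,\dots,c_n)\in\mathbb{R}^n$ (cleaning costs), $\mathbf{X}=(\mathbf{X}_1,\dots,\mathbf{X}_n)\in\mathbb{X}^n$ (voyage profiles), $\mathbf{B}=(B_0,B_1,\dots,B_n)\in\mathbb{R}^{n+1}$ (fouling increments) and $\tilde f:\mathbb{X}\times\mathbb{R}\to\mathbb{R}$ (fuel cost of a voyage given accumulated fouling), the problem is $$\min_{\mathbf{z}\in\{0,1\}^n,\ \mathbf{b}\in\mathbb{R}^n}\ \sum_{j=1}^n\tilde f(\mathbf{X}_j,b_j)+\sum_{j=1}^n c_j z_j$$ subject to, for each $j=1,\dots,n$: $b_j=b_{j-1}+B_{j-1}$ if $z_j=0$, and $b_j=0$ if $z_j=1$, with the convention $b_0=0$ (so $b_1=B_0$ if $z_1=0$). SUB-PROBLEM$[i,j]$. Given an instance of CLEANING-2 of size $n$ with parameters $(\mathbf{c},\mathbf{X},\mathbf{B},\tilde f)$ and indices $0\le j<i\le n$, SUB-PROBLEM$[i,j]$ is the instance of CLEANING-2 of size $n-i+1$ with parameters $(\mathbf{c}',\mathbf{X}',\mathbf{B}',\tilde f)$, where $\mathbf{c}'=(c_i,\dots,c_n)$, $\mathbf{X}'=(\mathbf{X}_i,\dots,\mathbf{X}_n)$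 and $\mathbf{B}'=\bigl(\sum_{k=j}^{i-1}B_k,\,B_i,\dots,B_n\bigr)$ (its entries playing the roles of $B_0,B_1,\dots$ in the new instance). *)

theory Defs
  imports "HOL-Library.FuncSet" "Jordan_Normal_Form.Matrix"
begin

definition voyage_profiles :: "nat \<Rightarrow> real mat set" where
  "voyage_profiles q = (\<Union>m. carrier_mat m q)"

text \<open>
  Finite tuples are functions on \<^typ>\<open>nat\<close>: in an instance of size \<open>n\<close>, only the values of
  \<open>cost\<close> and \<open>profile\<close> on \<open>{1..n}\<close> and of \<open>fouling\<close> on \<open>{0..n}\<close> are meaningful. Likewise
  \<open>fuel\<close> is meaningful only when its first argument is a voyage profile.
\<close>

record cleaning2 =
  voyages :: nat
  cost :: "nat \<Rightarrow> real"
  profile :: "nat \<Rightarrow> real mat"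
  fouling :: "nat \<Rightarrow> real"
  fuel :: "real mat \<Rightarrow> real \<Rightarrow> real"

definition cleaning2_instance :: "nat \<Rightarrow> cleaning2 \<Rightarrow> bool" where
  "cleaning2_instance q P \<longleftrightarrow> (\<forall>k\<in>{1..voyages P}. profile P k \<in> voyage_profiles q)"

text \<open>The convention \<open>b\<^sub>0 = 0\<close>; a decision vector \<open>b\<close> itself has index set \<open>{1..n}\<close> only.\<close>

definition prev_fouling :: "(nat \<Rightarrow> real) \<Rightarrow> nat \<Rightarrow> real" where
  "prev_fouling b k = (if k = 1 then 0 else b (k - 1))"

definition cleaning2_feasible :: "cleaning2 \<Rightarrow> ((nat \<Rightarrow> real) \<times> (nat \<Rightarrow> real)) set" where
  "cleaning2_feasible P =
    {(z, b). z \<in> {1..voyages P} \<rightarrow>\<^sub>E {0, 1} \<and> b \<in> {1..voyages P} \<rightarrow>\<^sub>E UNIV \<and>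
      (\<forall>k\<in>{1..voyages P}.
        (z k = 0 \<longrightarrow> b k = prev_fouling b k + fouling P (k - 1)) \<and>
        (z k = 1 \<longrightarrow> b k = 0))}"

definition cleaning2_objective :: "cleaning2 \<Rightarrow> (nat \<Rightarrow> real) \<times> (nat \<Rightarrow> real) \<Rightarrow> real" where
  "cleaning2_objective P = (\<lambda>(z, b).
    (\<Sum>k=1..voyages P. fuel P (profile P k) (b k)) + (\<Sum>k=1..voyages P. cost P k * z k))"

text \<open>
  The minimum of the attained objective values. It exists for every \<open>P\<close>; see
  \<open>cleaning2_optimum_attained\<close> below.
\<close>

definition cleaning2_optimum :: "cleaning2 \<Rightarrow> real" where
  "cleaning2_optimum P = (LEAST v. v \<in> cleaning2_objective P ` cleaning2_feasible P)"

text \<open>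
  The tuples are shifted so that voyage \<open>i\<close> becomes voyage \<open>1\<close>. Intended for
  \<open>j < i \<le> voyages P\<close>, so that the subtractions do not truncate.
\<close>

definition sub_problem :: "cleaning2 \<Rightarrow> nat \<Rightarrow> nat \<Rightarrow> cleaning2" where
  "sub_problem P i j =
    \<lparr>voyages = voyages P - i + 1,
     cost = (\<lambda>k. cost P (i + k - 1)),
     profile = (\<lambda>k. profile P (i + k - 1)),
     fouling = (\<lambda>k. if k = 0 then (\<Sum>l=j..i - 1. fouling P l) else fouling P (i + k - 1)),
     fuel = fuel P\<rparr>"

definition sub_optimum :: "cleaning2 \<Rightarrow> nat \<Rightarrow> nat \<Rightarrow> real" where
  "sub_optimum P i j = cleaning2_optimum (sub_problem P i j)"

lemma cleaning2_feasible_nonempty: "cleaning2_feasible P \<noteq> {}"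
proof -
  have "(restrict (\<lambda>_. 1) {1..voyages P}, restrict (\<lambda>_. 0) {1..voyages P}) \<in> cleaning2_feasible P"
    by (auto simp: cleaning2_feasible_def)
  then show ?thesis by blast
qed

lemma finite_cleaning2_feasible: "finite (cleaning2_feasible P)"
proof (rule finite_imageD)
  have "fst ` cleaning2_feasible P \<subseteq> {1..voyages P} \<rightarrow>\<^sub>E {0, 1}"
    by (auto simp: cleaning2_feasible_def)
  then show "finite (fst ` cleaning2_feasible P)"
    by (rule finite_subset) (auto intro: finite_PiE)
  show "inj_on fst (cleaning2_feasible P)"
  proof (rule inj_onI, clarsimp)
    fix z b b'
    assume *: "(z, b) \<in> cleaning2_feasible P" "(z, b') \<in> cleaning2_feasible P"
    have "k \<in> {1..voyages P} \<longrightarrow> b k = b' k" for k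
    proof (induction k rule: less_induct)
      case (less k)
      show ?case
      proof
        assume k: "k \<in> {1..voyages P}"
        then have "prev_fouling b k = prev_fouling b' k"
          using less.IH[of "k - 1"] by (auto simp: prev_fouling_def)
        moreover have "z k = 0 \<or> z k = 1"
          using * k by (auto simp: cleaning2_feasible_def PiE_def Pi_def)
        ultimately show "b k = b' k"
          using * k by (auto simp: cleaning2_feasible_def)
      qed
    qed
    moreover have "b \<in> extensional {1..voyages P}" "b' \<in> extensional {1..voyages P}"
      using * by (auto simp: cleaning2_feasible_def PiE_def)
    ultimately show "b = b'"
      by (meson extensionalityI)
  qed
qed

lemma cleaning2_optimum_attained:
  shows "cleaning2_optimum P \<in> cleaning2_objective P ` cleaning2_feasible P"
    and "s \<in> cleaning2_feasible P \<Longrightarrow> cleaning2_optimum P \<le> cleaning2_objective P s"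
proof -
  let ?V = "cleaning2_objective P ` cleaning2_feasible P"
  have V: "finite ?V" "?V \<noteq> {}"
    using finite_cleaning2_feasible cleaning2_feasible_nonempty by auto
  have "cleaning2_optimum P = Min ?V"
    unfolding cleaning2_optimum_def using V by (intro Least_equality) auto
  then show "cleaning2_optimum P \<in> ?V"
    and "s \<in> cleaning2_feasible P \<Longrightarrow> cleaning2_optimum P \<le> cleaning2_objective P s"
    using V by auto
qed

end

theory Submission
  imports Defs
begin

text \<open>
  Condition on the decision for the first voyage. It fixes the fouling of that voyage, and the
  remaining decisions are then exactly the feasible points of the instance without that voyage,
  whose initial fouling increment is the fouling accumulated so far.
\<close>

definition drop_first :: "cleaning2 \<Rightarrow> real \<Rightarrow> cleaning2" where
  "drop_first P d =
    \<lparr>voyages = voyages P - 1,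
     cost = (\<lambda>k. cost P (Suc k)),
     profile = (\<lambda>k. profile P (Suc k)),
     fouling = (\<lambda>k. if k = 0 then d else fouling P (Suc k)),
     fuel = fuel P\<rparr>"

text \<open>Decision vectors are extensional functions indexed from 1, so index 0 gets
  \<open>undefined\<close>; extensionality of \<open>f\<close> then carries over to the longer
  vector.\<close>

definition cons_decision :: "real \<Rightarrow> (nat \<Rightarrow> real) \<Rightarrow> nat \<Rightarrow> real" where
  "cons_decision x f k = (if k = 0 then undefined else if k = 1 then x else f (k - 1))"

lemma cons_decision_simps [simp]:
  "cons_decision x f (Suc 0) = x"
  "0 < k \<Longrightarrow> cons_decision x f (Suc k) = f k"
  by (auto simp: cons_decision_def)

lemma ball_atLeast1_atMost_Suc:
  "(\<forall>k\<in>{1..Suc N}. R k) \<longleftrightarrow> R 1 \<and> (\<forall>k\<in>{1..N}. R (Suc k))"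
proof -
  have "{1..Suc N} = insert 1 (Suc ` {1..N})"
    by (auto simp: image_Suc_atLeastAtMost)
  then show ?thesis
    by (simp del: image_Suc_atLeastAtMost)
qed

lemma cons_decision_PiE:
  assumes "f \<in> {1..N} \<rightarrow>\<^sub>E A" "x \<in> A"
  shows "cons_decision x f \<in> {1..Suc N} \<rightarrow>\<^sub>E A"
proof (rule PiE_I)
  fix k assume "k \<in> {1..Suc N}"
  then show "cons_decision x f k \<in> A"
    using assms by (cases k) (auto simp: cons_decision_def PiE_def Pi_def)
next
  fix k assume "k \<notin> {1..Suc N}"
  then have "k = 0 \<or> k \<noteq> 1 \<and> k - 1 \<notin> {1..N}"
    by auto
  then show "cons_decision x f k = undefined"
    using PiE_arb[OF assms(1), of "k - 1"] unfolding cons_decision_def by presburger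
qed

lemma cons_decision_surj:
  assumes "f \<in> {1..Suc N} \<rightarrow>\<^sub>E A"
  obtains x g where "x \<in> A" "g \<in> {1..N} \<rightarrow>\<^sub>E A" "f = cons_decision x g"
proof
  show "f 1 \<in> A"
    using assms by auto
  show "(\<lambda>k\<in>{1..N}. f (Suc k)) \<in> {1..N} \<rightarrow>\<^sub>E A"
    using assms by auto
  show "f = cons_decision (f 1) (\<lambda>k\<in>{1..N}. f (Suc k))"
  proof
    fix k
    show "f k = cons_decision (f 1) (\<lambda>k\<in>{1..N}. f (Suc k)) k"
      using PiE_arb[OF assms, of k] by (auto simp: cons_decision_def)
  qed
qed

text \<open>Past the first voyage, only the constraint of the second one can refer to
  \<open>\<beta>\<close>. The shorter instance starts from zero fouling, so \<open>\<beta>\<close>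
  is moved into its initial increment.\<close>

lemma cons_decision_feasible_iff:
  assumes "voyages P = Suc N"
    and "z \<in> {1..N} \<rightarrow>\<^sub>E {0, 1}" "b \<in> {1..N} \<rightarrow>\<^sub>E UNIV" "\<zeta> \<in> {0, 1}"
  shows "(cons_decision \<zeta> z, cons_decision \<beta> b) \<in> cleaning2_feasible P \<longleftrightarrow>
    \<beta> = (if \<zeta> = 0 then fouling P 0 else 0) \<and>
    (z, b) \<in> cleaning2_feasible (drop_first P (\<beta> + fouling P 1))"
proof -
  let ?Q = "drop_first P (\<beta> + fouling P 1)"
  \<comment> \<open>At \<open>k = 1\<close> the term \<open>prev_fouling b k\<close> is 0 and
    increment 0 of \<open>?Q\<close> supplies \<open>\<beta>\<close>; for larger \<open>k\<close>
    this is a plain shift.\<close>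
  have prev: "prev_fouling (cons_decision \<beta> b) (Suc k) + fouling P k =
      prev_fouling b k + fouling ?Q (k - 1)" if "k \<in> {1..N}" for k
    using that by (auto simp: prev_fouling_def cons_decision_def drop_first_def)
  show ?thesis
    unfolding cleaning2_feasible_def mem_Collect_eq case_prod_conv assms(1)
      ball_atLeast1_atMost_Suc
    using assms cons_decision_PiE[OF assms(2,4)] cons_decision_PiE[OF assms(3), of \<beta>]
    by (auto simp: prev[simplified] drop_first_def prev_fouling_def[of _ "Suc 0"])
qed

text \<open>Increments influence the cost only through the fouling vector, so \<open>d\<close> stays
  free until feasibility fixes it.\<close>

lemma cons_decision_objective:
  assumes "voyages P = Suc N"
  shows "cleaning2_objective P (cons_decision \<zeta> z, cons_decision \<beta> b) =
    fuel P (profile P 1) \<beta> + cost P 1 * \<zeta> + cleaning2_objective (drop_first P d) (z, b)"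
proof -
  have shift: "(\<Sum>k=1..Suc N. g k) = g 1 + (\<Sum>k=1..N. g (Suc k))" for g :: "nat \<Rightarrow> real"
    by (simp add: sum.atLeast_Suc_atMost sum.shift_bounds_cl_Suc_ivl del: sum.cl_ivl_Suc)
  show ?thesis
    unfolding cleaning2_objective_def case_prod_conv assms shift
    by (simp add: drop_first_def assms)
qed

text \<open>Bellman recursion for one voyage: fixing the first decision makes the cost of the first
  voyage constant, leaving only the tail to be minimised.\<close>

lemma cleaning2_optimum_drop_first:
  assumes "voyages P = Suc N"
  shows "cleaning2_optimum P =
    min (fuel P (profile P 1) 0 + cost P 1 + cleaning2_optimum (drop_first P (fouling P 1)))
      (fuel P (profile P 1) (fouling P 0) +
        cleaning2_optimum (drop_first P (fouling P 0 + fouling P 1)))"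
    (is "_ = ?m")
proof (rule antisym)
  \<comment> \<open>An optimal solution of the shorter instance, with the decision prepended, is
    feasible for \<open>P\<close>.\<close>
  have upper: "cleaning2_optimum P \<le> fuel P (profile P 1) \<beta> + cost P 1 * \<zeta> +
      cleaning2_optimum (drop_first P (\<beta> + fouling P 1))"
    if "\<zeta> \<in> {0, 1}" "\<beta> = (if \<zeta> = 0 then fouling P 0 else 0)" for \<zeta> \<beta>
  proof -
    let ?Q = "drop_first P (\<beta> + fouling P 1)"
    obtain z b where zb: "(z, b) \<in> cleaning2_feasible ?Q"
      and opt: "cleaning2_optimum ?Q = cleaning2_objective ?Q (z, b)"
      using cleaning2_optimum_attained(1)[of ?Q] by auto
    have "z \<in> {1..N} \<rightarrow>\<^sub>E {0, 1}" "b \<in> {1..N} \<rightarrow>\<^sub>E UNIV"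
      using zb assms by (auto simp: cleaning2_feasible_def drop_first_def)
    then have "(cons_decision \<zeta> z, cons_decision \<beta> b) \<in> cleaning2_feasible P"
      using cons_decision_feasible_iff[OF assms, of z b \<zeta> \<beta>] that zb by blast
    then show ?thesis
      using cleaning2_optimum_attained(2)[of _ P] cons_decision_objective[OF assms] opt
      by metis
  qed
  show "cleaning2_optimum P \<le> ?m"
    using upper[of 1 0] upper[of 0 "fouling P 0"] by simp
  \<comment> \<open>Conversely, an optimal solution of \<open>P\<close> is split; its tail is
    feasible for the shorter instance and costs at least the optimum there.\<close>
  obtain z' b' where feas: "(z', b') \<in> cleaning2_feasible P"
    and opt: "cleaning2_optimum P = cleaning2_objective P (z', b')"
    using cleaning2_optimum_attained(1)[of P] by auto
  have z': "z' \<in> {1..Suc N} \<rightarrow>\<^sub>E {0, 1}" and b': "b' \<in> {1..Suc N} \<rightarrow>\<^sub>E UNIV"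
    using feas assms by (auto simp: cleaning2_feasible_def)
  obtain \<zeta> z where z: "\<zeta> \<in> {0, 1}" "z \<in> {1..N} \<rightarrow>\<^sub>E {0, 1}" "z' = cons_decision \<zeta> z"
    using cons_decision_surj[OF z'] .
  obtain \<beta> b where b: "b \<in> {1..N} \<rightarrow>\<^sub>E UNIV" "b' = cons_decision \<beta> b"
    using cons_decision_surj[OF b'] .
  let ?Q = "drop_first P (\<beta> + fouling P 1)"
  have \<beta>: "\<beta> = (if \<zeta> = 0 then fouling P 0 else 0)" and "(z, b) \<in> cleaning2_feasible ?Q"
    using cons_decision_feasible_iff[OF assms z(2) b(1) z(1), of \<beta>] feas z b by auto
  then have "cleaning2_optimum ?Q \<le> cleaning2_objective ?Q (z, b)"
    by (intro cleaning2_optimum_attained(2))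
  then have "fuel P (profile P 1) \<beta> + cost P 1 * \<zeta> + cleaning2_optimum ?Q \<le> cleaning2_optimum P"
    using opt z(3) b(2)
      cons_decision_objective[OF assms, where \<zeta>=\<zeta> and z=z and \<beta>=\<beta> and b=b and d="\<beta> + fouling P 1"]
    by simp
  \<comment> \<open>The branch of the actual \<open>\<zeta>\<close> suffices, as the minimum lies
    below both.\<close>
  then show "?m \<le> cleaning2_optimum P"
    using z(1) \<beta> by (auto simp: min_le_iff_disj)
qed

text \<open>The index \<open>j'\<close> enters only through increment 0, which \<open>d\<close>
  overwrites. By \<open>i < voyages P\<close> the voyage counts agree despite truncated
  subtraction.\<close>

lemma drop_first_sub_problem:
  assumes "i < voyages P" "d = (\<Sum>l=j..i. fouling P l)"
  shows "drop_first (sub_problem P i j') d = sub_problem P (i + 1) j"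
  using assms by (auto simp: drop_first_def sub_problem_def)

theorem theorem3p1:
  fixes P :: cleaning2 and q i j :: nat
  assumes "cleaning2_instance q P"
    and "j < i" and "i < voyages P"
  shows "sub_optimum P i j =
    min (fuel P (profile P i) 0 + cost P i + sub_optimum P (i + 1) i)
        (fuel P (profile P i) (\<Sum>k=j..i - 1. fouling P k) + sub_optimum P (i + 1) j)"
proof -
  let ?S = "sub_problem P i j"
  have first: "fuel ?S = fuel P" "profile ?S 1 = profile P i" "cost ?S 1 = cost P i"
    "fouling ?S 0 = (\<Sum>k=j..i - 1. fouling P k)" "fouling ?S 1 = fouling P i"
    by (auto simp: sub_problem_def)
  \<comment> \<open>Cleaning at voyage \<open>i\<close> resets the fouling, leaving
    \<open>fouling P i\<close> as the one-term sum over \<open>{i..i}\<close>.\<close>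
  have "drop_first ?S (fouling ?S 1) = sub_problem P (i + 1) i"
    unfolding first by (rule drop_first_sub_problem[OF \<open>i < voyages P\<close>]) simp
  \<comment> \<open>Without cleaning, \<open>fouling P i\<close> extends the sum from
    \<open>i - 1\<close> to \<open>i\<close>; since \<open>j < i\<close>, the index
    \<open>i - 1\<close> does not truncate.\<close>
  moreover have "drop_first ?S (fouling ?S 0 + fouling ?S 1) = sub_problem P (i + 1) j"
    unfolding first using \<open>j < i\<close>
    by (intro drop_first_sub_problem[OF \<open>i < voyages P\<close>]) (cases i, auto)
  moreover have "voyages ?S = Suc (voyages P - i)"
    by (simp add: sub_problem_def)
  ultimately show ?thesis
    using cleaning2_optimum_drop_first[of ?S] first unfolding sub_optimum_def by simp
qed

end
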